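(* There is an algorithm which, given a finite set $\mathbf{R}$ of $n$ decision procedures with runtimes $t_1,\dots,t_n$ and qualities $q_1,\dots,q_n$, and a short uniform deadline distribution (i.e. the deadline is uniformly distributed on an interval $[0,D]$, with cumulative distribution function $P_d$ satisfying $\sum_{i=1}^n P_d(t_i)>1$), determines an optimal sequence of decision procedures from $\mathbf{R}$ in $O(n^3)$ time.
   Context: A decision procedure (rule) $r$ has an integer runtime $t_r\ge 0$ and a real quality $q_r\ge 0$. A sequence (agent program) is a finite nonempty sequence $s=s_1\ldots s_m$ of elements of the finite set $\mathbf{R}$; its rules are run in order. A deadline occurs at a random nonnegative time with cumulative distribution function $P_d$ and is announced when it arrives; the agent then executes the action of the highest-quality rule completed so far. The value of $s$ is $$V(s)=\sum_{i=1}^{m}\Big[P_d\Big(\sum_{j=1}^{i+1}t_{s_j}\Big)-P_d\Big(\sum_{j=1}^{i}t_{s_j}\Big)\Big]Q_i,\qquad Q_i=\max\{q_{s_1},\dots,q_{s_i}\},$$ where for $i=m$ the term $P_d(\sum_{j=1}^{m+1}t_{s_j})$ is read as $1$. A sequence is optimal if it maximizes $V$ among all sequences over $\mathbf{R}$. Running time counts arithmetic operations and comparisons on real numbers and evaluations of $P_d$ as unit-cost steps. *)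

theory Defs
  imports "HOL-Probability.Probability" "HOL-Library.Landau_Symbols"
begin

text \<open>
  Rules are elements of a type \<open>'r\<close>, with runtimes \<open>t\<close> and qualities \<open>q\<close>.
  The argument \<open>i\<close> below counts completed rules, hence it is 1-based, whereas lists are 0-based.
\<close>

definition sequences :: "'r set \<Rightarrow> 'r list set" where
  "sequences R = {s. s \<noteq> [] \<and> set s \<subseteq> R}"

definition elapsed :: "('r \<Rightarrow> nat) \<Rightarrow> 'r list \<Rightarrow> nat \<Rightarrow> nat" where
  "elapsed t s i = (\<Sum>j<i. t (s ! j))"

definition best_quality :: "('r \<Rightarrow> real) \<Rightarrow> 'r list \<Rightarrow> nat \<Rightarrow> real" where
  "best_quality q s i = Max {q (s ! j) | j. j < i}"

definition seq_value ::
    "(real \<Rightarrow> real) \<Rightarrow> ('r \<Rightarrow> nat) \<Rightarrow> ('r \<Rightarrow> real) \<Rightarrow> 'r list \<Rightarrow> real" where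
  "seq_value P t q s =
     (\<Sum>i = 1..length s.
        ((if i = length s then 1 else P (real (elapsed t s (i + 1))))
          - P (real (elapsed t s i))) * best_quality q s i)"

definition optimal_sequence ::
    "(real \<Rightarrow> real) \<Rightarrow> 'r set \<Rightarrow> ('r \<Rightarrow> nat) \<Rightarrow> ('r \<Rightarrow> real) \<Rightarrow> 'r list \<Rightarrow> bool" where
  "optimal_sequence P R t q s \<longleftrightarrow> is_arg_max (seq_value P t q) (\<lambda>s. s \<in> sequences R) s"

definition uniform_deadline :: "(real \<Rightarrow> real) \<Rightarrow> bool" where
  "uniform_deadline P \<longleftrightarrow> (\<exists>D>0. P = cdf (uniform_measure lborel {0..D}))"

definition short_uniform_deadline :: "(real \<Rightarrow> real) \<Rightarrow> 'r set \<Rightarrow> ('r \<Rightarrow> nat) \<Rightarrow> bool" where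
  "short_uniform_deadline P R t \<longleftrightarrow> uniform_deadline P \<and> (\<Sum>r\<in>R. P (real (t r))) > 1"

text \<open>
  The model of computation is a real RAM with an oracle for the distribution function.
  Programs manipulate natural-number registers and arrays (used for indices) and real registers
  and arrays. Reals can only be combined arithmetically, compared, and passed to the oracle: there
  is no rounding and no other way to turn a real into an index. Every instruction and every
  evaluation of a test costs one step, so the index arithmetic and data movement are charged
  as well as the operations on reals. The distribution function is accessible only through
  \<open>Oracle\<close>; in particular the endpoint of its support is not part of the input.
\<close>

type_synonym vname = string

record state =
  ireg :: "vname \<Rightarrow> nat"
  rreg :: "vname \<Rightarrow> real"
  iarr :: "vname \<Rightarrow> nat \<Rightarrow> nat"
  rarr :: "vname \<Rightarrow> nat \<Rightarrow> real"

datatype instr =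
    INum vname nat
  | ICopy vname vname
  | IAdd vname vname vname
  | ISub vname vname vname
  | ILoad vname vname vname
  | IStore vname vname vname
  | RNum vname int
  | RCopy vname vname
  | RAdd vname vname vname
  | RSub vname vname vname
  | RMul vname vname vname
  | RDiv vname vname vname
  | RLoad vname vname vname
  | RStore vname vname vname
  | Oracle vname vname

fun exec :: "(real \<Rightarrow> real) \<Rightarrow> instr \<Rightarrow> state \<Rightarrow> state" where
  "exec P (INum x k) \<sigma> = \<sigma>\<lparr>ireg := (ireg \<sigma>)(x := k)\<rparr>"
| "exec P (ICopy x y) \<sigma> = \<sigma>\<lparr>ireg := (ireg \<sigma>)(x := ireg \<sigma> y)\<rparr>"
| "exec P (IAdd x y z) \<sigma> = \<sigma>\<lparr>ireg := (ireg \<sigma>)(x := ireg \<sigma> y + ireg \<sigma> z)\<rparr>"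
| "exec P (ISub x y z) \<sigma> = \<sigma>\<lparr>ireg := (ireg \<sigma>)(x := ireg \<sigma> y - ireg \<sigma> z)\<rparr>"
| "exec P (ILoad x a i) \<sigma> = \<sigma>\<lparr>ireg := (ireg \<sigma>)(x := iarr \<sigma> a (ireg \<sigma> i))\<rparr>"
| "exec P (IStore a i x) \<sigma> =
     \<sigma>\<lparr>iarr := (iarr \<sigma>)(a := (iarr \<sigma> a)(ireg \<sigma> i := ireg \<sigma> x))\<rparr>"
| "exec P (RNum x k) \<sigma> = \<sigma>\<lparr>rreg := (rreg \<sigma>)(x := of_int k)\<rparr>"
| "exec P (RCopy x y) \<sigma> = \<sigma>\<lparr>rreg := (rreg \<sigma>)(x := rreg \<sigma> y)\<rparr>"
| "exec P (RAdd x y z) \<sigma> = \<sigma>\<lparr>rreg := (rreg \<sigma>)(x := rreg \<sigma> y + rreg \<sigma> z)\<rparr>"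
| "exec P (RSub x y z) \<sigma> = \<sigma>\<lparr>rreg := (rreg \<sigma>)(x := rreg \<sigma> y - rreg \<sigma> z)\<rparr>"
| "exec P (RMul x y z) \<sigma> = \<sigma>\<lparr>rreg := (rreg \<sigma>)(x := rreg \<sigma> y * rreg \<sigma> z)\<rparr>"
| "exec P (RDiv x y z) \<sigma> = \<sigma>\<lparr>rreg := (rreg \<sigma>)(x := rreg \<sigma> y / rreg \<sigma> z)\<rparr>"
| "exec P (RLoad x a i) \<sigma> = \<sigma>\<lparr>rreg := (rreg \<sigma>)(x := rarr \<sigma> a (ireg \<sigma> i))\<rparr>"
| "exec P (RStore a i x) \<sigma> =
     \<sigma>\<lparr>rarr := (rarr \<sigma>)(a := (rarr \<sigma> a)(ireg \<sigma> i := rreg \<sigma> x))\<rparr>"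
| "exec P (Oracle x y) \<sigma> = \<sigma>\<lparr>rreg := (rreg \<sigma>)(x := P (rreg \<sigma> y))\<rparr>"

datatype test =
    ILess vname vname
  | RLess vname vname

fun test_holds :: "test \<Rightarrow> state \<Rightarrow> bool" where
  "test_holds (ILess x y) \<sigma> \<longleftrightarrow> ireg \<sigma> x < ireg \<sigma> y"
| "test_holds (RLess x y) \<sigma> \<longleftrightarrow> rreg \<sigma> x < rreg \<sigma> y"

datatype com =
    Skip
  | Instr instr
  | Seq com com
  | Cond test com com
  | Loop test com

text \<open>\<open>run P c \<sigma> k \<sigma>'\<close>: started in \<open>\<sigma>\<close>, program \<open>c\<close> halts in \<open>\<sigma>'\<close> after \<open>k\<close> steps.\<close>

inductive run :: "(real \<Rightarrow> real) \<Rightarrow> com \<Rightarrow> state \<Rightarrow> nat \<Rightarrow> state \<Rightarrow> bool" for P where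
  run_Skip: "run P Skip \<sigma> 1 \<sigma>"
| run_Instr: "run P (Instr a) \<sigma> 1 (exec P a \<sigma>)"
| run_Seq: "run P c \<sigma> k \<sigma>' \<Longrightarrow> run P d \<sigma>' l \<sigma>'' \<Longrightarrow> run P (Seq c d) \<sigma> (k + l) \<sigma>''"
| run_CondT: "test_holds b \<sigma> \<Longrightarrow> run P c \<sigma> k \<sigma>' \<Longrightarrow> run P (Cond b c d) \<sigma> (1 + k) \<sigma>'"
| run_CondF: "\<not> test_holds b \<sigma> \<Longrightarrow> run P d \<sigma> k \<sigma>' \<Longrightarrow> run P (Cond b c d) \<sigma> (1 + k) \<sigma>'"
| run_LoopF: "\<not> test_holds b \<sigma> \<Longrightarrow> run P (Loop b c) \<sigma> 1 \<sigma>"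
| run_LoopT: "test_holds b \<sigma> \<Longrightarrow> run P c \<sigma> k \<sigma>' \<Longrightarrow> run P (Loop b c) \<sigma>' l \<sigma>'' \<Longrightarrow>
    run P (Loop b c) \<sigma> (1 + k + l) \<sigma>''"

inductive_cases run_SkipE: "run P Skip \<sigma> k \<sigma>'"
inductive_cases run_InstrE: "run P (Instr a) \<sigma> k \<sigma>'"
inductive_cases run_SeqE: "run P (Seq c d) \<sigma> k \<sigma>'"
inductive_cases run_CondE: "run P (Cond b c d) \<sigma> k \<sigma>'"
inductive_cases run_LoopE: "run P (Loop b c) \<sigma> k \<sigma>'"

lemma run_deterministic:
  "run P c \<sigma> k \<sigma>' \<Longrightarrow> run P c \<sigma> l \<sigma>'' \<Longrightarrow> l = k \<and> \<sigma>'' = \<sigma>'"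
proof (induction arbitrary: l \<sigma>'' rule: run.induct)
  case run_Skip
  from run_Skip.prems show ?case by (rule run_SkipE) simp
next
  case run_Instr
  from run_Instr.prems show ?case by (rule run_InstrE) simp
next
  case (run_Seq c \<sigma> k1 \<sigma>1 d k2 \<sigma>2)
  from run_Seq.prems obtain l1 l2 \<tau> where
    "l = l1 + l2" "run P c \<sigma> l1 \<tau>" "run P d \<tau> l2 \<sigma>''"
    by (rule run_SeqE)
  with run_Seq.IH(1)[of l1 \<tau>] run_Seq.IH(2)[of l2 \<sigma>''] show ?case by simp
next
  case (run_CondT b \<sigma> c k \<sigma>' d)
  from run_CondT.prems obtain l1 where "l = Suc l1" "run P c \<sigma> l1 \<sigma>''"
    by (rule run_CondE) (use run_CondT.hyps in simp_all)
  with run_CondT.IH[of l1 \<sigma>''] show ?case by simp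
next
  case (run_CondF b \<sigma> d k \<sigma>' c)
  from run_CondF.prems obtain l1 where "l = Suc l1" "run P d \<sigma> l1 \<sigma>''"
    by (rule run_CondE) (use run_CondF.hyps in simp_all)
  with run_CondF.IH[of l1 \<sigma>''] show ?case by simp
next
  case run_LoopF
  from run_LoopF.prems show ?case
    by (rule run_LoopE) (use run_LoopF.hyps in simp_all)
next
  case (run_LoopT b \<sigma> c k1 \<sigma>1 k2 \<sigma>2)
  from run_LoopT.prems obtain l1 l2 \<tau> where
    "l = Suc (l1 + l2)" "run P c \<sigma> l1 \<tau>" "run P (Loop b c) \<tau> l2 \<sigma>''"
    by (rule run_LoopE) (use run_LoopT.hyps in simp_all)
  with run_LoopT.IH(1)[of l1 \<tau>] run_LoopT.IH(2)[of l2 \<sigma>''] show ?case by simp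
qed

text \<open>
  An instance with \<open>n\<close> rules is presented with the rules numbered \<open>0, \<dots>, n - 1\<close>.
  Memory not holding input is arbitrary, so a program cannot rely on initial values there.
\<close>

definition input_state :: "nat \<Rightarrow> (nat \<Rightarrow> nat) \<Rightarrow> (nat \<Rightarrow> real) \<Rightarrow> state \<Rightarrow> bool" where
  "input_state n t q \<sigma> \<longleftrightarrow>
     ireg \<sigma> ''n'' = n \<and> (\<forall>i<n. rarr \<sigma> ''t'' i = real (t i) \<and> rarr \<sigma> ''q'' i = q i)"

definition output_sequence :: "state \<Rightarrow> nat list" where
  "output_sequence \<sigma> = map (iarr \<sigma> ''s'') [0..<ireg \<sigma> ''m'']"

end

theory Submission
  imports Defs
begin

text \<open>
  On nonnegative arguments a uniform distribution function \<open>P\<close> is subadditive, and it is additive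
  as long as it stays below 1. Hence replacing \<open>P\<close> of a sum of runtimes by the sum of the
  \<open>P (t r)\<close> gives a lower bound for the value of a sequence. Unless the
  optimal value is 0, and then every sequence is optimal, the bound is attained by an optimal
  sequence that completes within the support and whose qualities do not decrease. Such sequences are
  paths through the rules in order of quality. For a fixed last rule with quality \<open>M\<close> the bound is
  \<open>M\<close> minus the sum of \<open>P (t y) * (M - q x)\<close> over the edges from \<open>x\<close> to \<open>y\<close> of the path, with
  quality 0 before the first rule. A shortest path for each of the \<open>n\<close> last rules takes quadratic
  time, which gives \<open>O(n^3)\<close>; the endpoint of the support is never needed.
\<close>

section \<open>Values of sequences\<close>

text \<open>The normalized measure of \<open>{..x}\<close> is the length of
  \<open>{0..min D x}\<close> divided by \<open>D\<close>. Only times occur as arguments, so the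
  formula needs no clamp at 0.\<close>

lemma uniform_deadline_eq:
  assumes "uniform_deadline P"
  obtains D where "D > 0" "\<And>x. 0 \<le> x \<Longrightarrow> P x = min 1 (x / D)"
proof -
  from assms obtain D where D: "D > 0" "P = cdf (uniform_measure lborel {0..D})"
    unfolding uniform_deadline_def by blast
  have "P x = min 1 (x / D)" if "0 \<le> x" for x
  proof -
    have *: "{0..D} \<inter> {..x} = {0..min D x}" by auto
    show ?thesis
      using D that by (auto simp: cdf_def measure_uniform_measure * min_def divide_simps)
  qed
  with D(1) show thesis by (rule that)
qed

text \<open>The value still to be collected at time \<open>\<tau>\<close>, when the best completed quality is \<open>b\<close>.\<close>

fun remaining_value ::
    "(real \<Rightarrow> real) \<Rightarrow> ('r \<Rightarrow> nat) \<Rightarrow> ('r \<Rightarrow> real) \<Rightarrow> nat \<Rightarrow> real \<Rightarrow> 'r list \<Rightarrow> real" where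
  "remaining_value P t q \<tau> b [] = (1 - P (real \<tau>)) * b"
| "remaining_value P t q \<tau> b (r # s) =
     (P (real (\<tau> + t r)) - P (real \<tau>)) * b + remaining_value P t q (\<tau> + t r) (max b (q r)) s"

lemma elapsed_Cons_Suc: "elapsed t (r # s) (Suc i) = t r + elapsed t s i"
  unfolding elapsed_def by (subst sum.lessThan_Suc_shift) simp

lemma prefix_qualities_Cons:
  "{q ((r # s) ! j) | j. j < Suc i} = insert (q r) {q (s ! j) | j. j < i}"
  by (simp add: setcompr_eq_image lessThan_def[symmetric] lessThan_Suc_eq_insert_0 image_image)

text \<open>The recursion unfolds to the sum in \<open>seq_value\<close> with a further summand
  \<open>i = 0\<close>, the period before the first rule completes. There no quality has been
  completed, and inserting \<open>b\<close> keeps the maximum defined.\<close>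

lemma remaining_value_eq_sum:
  "remaining_value P t q \<tau> b s =
     (\<Sum>i\<le>length s.
        ((if i = length s then 1 else P (real (\<tau> + elapsed t s (i + 1))))
          - P (real (\<tau> + elapsed t s i))) * Max (insert b {q (s ! j) | j. j < i}))"
proof (induction s arbitrary: \<tau> b)
  case Nil
  then show ?case by (simp add: elapsed_def)
next
  case (Cons r s)
  have Max_eq: "Max (insert b {q ((r # s) ! j) | j. j < Suc i})
      = Max (insert (max b (q r)) {q (s ! j) | j. j < i})" for i
  proof -
    have "finite {q (s ! j) | j. j < i}" by simp
    then show ?thesis
      by (cases "{q (s ! j) | j. j < i} = {}")
        (simp_all add: prefix_qualities_Cons Max_insert max.assoc del: Collect_empty_eq)
  qed
  have *: "elapsed t s' 0 = 0" "elapsed t (r # s) (Suc 0) = t r" for s'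
    by (simp_all add: elapsed_def)
  show ?case
    by (simp add: sum.atMost_Suc_shift Max_eq Cons.IH elapsed_Cons_Suc add.assoc * del: sum.atMost_Suc cong: if_cong)
qed

text \<open>With initial quality 0 the summand \<open>i = 0\<close> vanishes, and nonnegative
  qualities make the inserted 0 invisible to every other maximum.\<close>

lemma seq_value_eq_remaining_value:
  assumes "P 0 = 0" "s \<noteq> []" "\<And>r. r \<in> set s \<Longrightarrow> 0 \<le> q r"
  shows "seq_value P t q s = remaining_value P t q 0 0 s"
proof -
  have *: "Max (insert 0 {q (s ! j) | j. j < i}) = best_quality q s i"
    if i: "i \<in> {1..length s}" for i
  proof -
    have "0 \<le> q (s ! 0)" using assms by simp
    also have "q (s ! 0) \<le> best_quality q s i"
      unfolding best_quality_def by (rule Max_ge) (use i in auto)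
    finally show ?thesis
      unfolding best_quality_def by (subst Max_insert) (use i in \<open>auto simp: max_def intro: exI[of _ 0]\<close>)
  qed
  have "{..length s} = insert 0 {1..length s}" by auto
  then have "remaining_value P t q 0 0 s = (\<Sum>i\<in>{1..length s}.
        ((if i = length s then 1 else P (real (elapsed t s (i + 1))))
          - P (real (elapsed t s i))) * Max (insert 0 {q (s ! j) | j. j < i}))"
    by (simp add: remaining_value_eq_sum cong: if_cong)
  also have "\<dots> = seq_value P t q s"
    unfolding seq_value_def by (rule sum.cong) (simp_all only: *)
  finally show ?thesis ..
qed

section \<open>Paths through the sorted rules\<close>

text \<open>While \<open>y\<close> runs, quality \<open>b x\<close> is available instead of the
  final quality \<open>M\<close>; an edge is charged this shortfall, weighted with
  \<open>a y\<close>. The start \<open>x\<close> is kept outside the list.\<close>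

fun path_cost :: "(nat \<Rightarrow> real) \<Rightarrow> (nat \<Rightarrow> real) \<Rightarrow> real \<Rightarrow> nat \<Rightarrow> nat list \<Rightarrow> real" where
  "path_cost a b M x [] = 0"
| "path_cost a b M x (y # ys) = a y * (M - b x) + path_cost a b M y ys"

lemma path_cost_snoc:
  "path_cost a b M x (ys @ [y]) = path_cost a b M x ys + a y * (M - b (last (x # ys)))"
  by (induction ys arbitrary: x) auto

lemma last_path_le: "sorted_wrt (>) (x # ys) \<Longrightarrow> last (x # ys) \<le> (x :: nat)"
  by (cases ys rule: rev_cases) auto

text \<open>
  The rules are numbered by decreasing quality, and the extra index \<open>n\<close> with quality 0 stands for
  the start, before any rule is completed. Thus a sequence of increasing quality is a path with
  decreasing indices from \<open>n\<close>.
\<close>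

definition sorted_data ::
    "(real \<Rightarrow> real) \<Rightarrow> nat \<Rightarrow> (nat \<Rightarrow> nat) \<Rightarrow> (nat \<Rightarrow> real) \<Rightarrow>
     (nat \<Rightarrow> real) \<Rightarrow> (nat \<Rightarrow> real) \<Rightarrow> (nat \<Rightarrow> nat) \<Rightarrow> bool" where
  "sorted_data P n t q a b ord \<longleftrightarrow>
     bij_betw ord {..<n} {..<n} \<and> b n = 0 \<and>
     (\<forall>x<n. a x = P (real (t (ord x))) \<and> b x = q (ord x)) \<and>
     (\<forall>x y. x \<le> y \<longrightarrow> y \<le> n \<longrightarrow> b y \<le> b x)"

locale sorted_instance =
  fixes P :: "real \<Rightarrow> real" and n :: nat and t :: "nat \<Rightarrow> nat" and q :: "nat \<Rightarrow> real"
    and a b :: "nat \<Rightarrow> real" and ord :: "nat \<Rightarrow> nat"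
  assumes uniform: "uniform_deadline P"
    and q_nonneg: "\<And>i. i < n \<Longrightarrow> 0 \<le> q i"
    and sorted: "sorted_data P n t q a b ord"
begin

section \<open>Elementary properties of a uniform distribution function\<close>

lemma P_0: "P 0 = 0"
  using uniform by (rule uniform_deadline_eq) simp

lemma P_nonneg: "0 \<le> x \<Longrightarrow> 0 \<le> P x"
  using uniform by (rule uniform_deadline_eq) simp

lemma P_le_1: "0 \<le> x \<Longrightarrow> P x \<le> 1"
  using uniform by (rule uniform_deadline_eq) simp

lemma P_mono: "0 \<le> x \<Longrightarrow> x \<le> y \<Longrightarrow> P x \<le> P y"
  using uniform by (rule uniform_deadline_eq) (simp add: min_def divide_simps)

lemma P_subadditive: "0 \<le> x \<Longrightarrow> 0 \<le> y \<Longrightarrow> P (x + y) \<le> P x + P y"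
  using uniform by (rule uniform_deadline_eq) (auto simp: min_def divide_simps)

lemma P_additive: "0 \<le> x \<Longrightarrow> 0 \<le> y \<Longrightarrow> P (x + y) \<noteq> 1 \<Longrightarrow> P (x + y) = P x + P y"
  using uniform by (rule uniform_deadline_eq) (auto simp: min_def divide_simps split: if_splits)

lemma b_antimono: "x \<le> y \<Longrightarrow> y \<le> n \<Longrightarrow> b y \<le> b x"
  and b_n: "b n = 0"
  and a_eq: "x < n \<Longrightarrow> a x = P (real (t (ord x)))"
  and b_eq: "x < n \<Longrightarrow> b x = q (ord x)"
  and ord_less: "x < n \<Longrightarrow> ord x < n"
  using sorted by (auto simp: sorted_data_def bij_betw_def)

lemma ord_surj: "i < n \<Longrightarrow> \<exists>x<n. ord x = i"
  using sorted unfolding sorted_data_def bij_betw_def by (metis imageE lessThan_iff)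

section \<open>Path bounds for the values of sequences\<close>

lemma remaining_value_after_deadline:
  "P (real \<tau>) = 1 \<Longrightarrow> remaining_value P t q \<tau> c s = 0"
proof (induction s arbitrary: \<tau> c)
  case (Cons r s)
  have "P (real (\<tau> + t r)) = 1"
    using P_mono[of "real \<tau>" "real (\<tau> + t r)"] P_le_1[of "real (\<tau> + t r)"] Cons.prems by simp
  with Cons show ?case by simp
qed simp

text \<open>By subadditivity, running \<open>y\<close> uses up probability at most
  \<open>a y\<close>. During that time the shortfall against the final quality is
  \<open>b (last (x # ys)) - b x\<close>, which is nonnegative, so the loss is at most the edge
  cost.\<close>

lemma remaining_value_path_ge:
  assumes "x \<le> n" "sorted_wrt (>) (x # ys)"
  shows "(1 - P (real \<tau>)) * b (last (x # ys)) - path_cost a b (b (last (x # ys))) x ys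
    \<le> remaining_value P t q \<tau> (b x) (map ord ys)"
  using assms
proof (induction ys arbitrary: x \<tau>)
  case (Cons y ys)
  let ?M = "b (last (y # ys))" and ?\<tau> = "\<tau> + t (ord y)"
  have y: "y < x" "y < n" "sorted_wrt (>) (y # ys)" using Cons.prems by auto
  have "last (y # ys) \<le> y" using y(3) by (rule last_path_le)
  then have M: "b x \<le> ?M" using y Cons.prems by (intro b_antimono) auto
  have m: "max (b x) (q (ord y)) = b y"
    using b_antimono[of y x] y Cons.prems by (simp add: b_eq)
  have "P (real ?\<tau>) - P (real \<tau>) \<le> a y"
    using P_subadditive[of "real \<tau>" "real (t (ord y))"] y by (simp add: a_eq)
  then have "(P (real ?\<tau>) - P (real \<tau>)) * (?M - b x) \<le> a y * (?M - b x)"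
    using M by (intro mult_right_mono) auto
  moreover have "(1 - P (real ?\<tau>)) * ?M - path_cost a b ?M y ys
    \<le> remaining_value P t q ?\<tau> (b y) (map ord ys)"
    using y by (intro Cons.IH) auto
  ultimately show ?case by (simp add: m algebra_simps)
qed simp

text \<open>The path keeps those rules of \<open>s\<close> whose index is below all indices kept
  before, and stops at the first rule that completes where \<open>P\<close> is 1. Before that point
  \<open>P\<close> is additive, so kept rules cost exactly their edge; skipped rules only lose
  time.\<close>

lemma remaining_value_le_path:
  assumes "x \<le> n" "set s \<subseteq> {..<n}"
  shows "\<exists>ys. sorted_wrt (>) (x # ys) \<and> remaining_value P t q \<tau> (b x) s
    \<le> (1 - P (real \<tau>)) * b (last (x # ys)) - path_cost a b (b (last (x # ys))) x ys"
  using assms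
proof (induction s arbitrary: x \<tau>)
  case Nil
  then show ?case by (intro exI[of _ "[]"]) simp
next
  case (Cons r s)
  from Cons.prems obtain y where y: "y < n" "ord y = r" using ord_surj[of r] by auto
  let ?\<tau> = "\<tau> + t r"
  show ?case
  proof (cases "P (real ?\<tau>) = 1")
    case True
    \<comment> \<open>Nothing is collected after \<open>r\<close> completes, so the value is that of
      holding \<open>b x\<close> to the end: the empty path.\<close>
    then show ?thesis
      by (intro exI[of _ "[]"]) (use remaining_value_after_deadline[OF True] in simp)
  next
    case False
    then have P: "P (real ?\<tau>) = P (real \<tau>) + a y"
      using P_additive[of "real \<tau>" "real (t r)"] y by (simp add: a_eq)
    show ?thesis
    proof (cases "y < x")
      case True
      have m: "max (b x) (q r) = b y"
        using b_antimono[of y x] y Cons.prems True by (simp add: b_eq)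
      obtain ys where ys: "sorted_wrt (>) (y # ys)" "remaining_value P t q ?\<tau> (b y) s
        \<le> (1 - P (real ?\<tau>)) * b (last (y # ys)) - path_cost a b (b (last (y # ys))) y ys"
        using Cons.IH[of y ?\<tau>] y Cons.prems by auto
      show ?thesis
        by (intro exI[of _ "y # ys"]) (use ys True P m in \<open>auto simp: algebra_simps\<close>)
    next
      case False
      have m: "max (b x) (q r) = b x"
        using b_antimono[of x y] y Cons.prems False by (simp add: b_eq)
      obtain ys where ys: "sorted_wrt (>) (x # ys)" "remaining_value P t q ?\<tau> (b x) s
        \<le> (1 - P (real ?\<tau>)) * b (last (x # ys)) - path_cost a b (b (last (x # ys))) x ys"
        using Cons.IH[of x ?\<tau>] Cons.prems by auto
      \<comment> \<open>The sequence earns only \<open>b x\<close> while \<open>r\<close> runs,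
        whereas the path that skips \<open>r\<close> may count this time at its final
        quality.\<close>
      have "b x \<le> b (last (x # ys))"
        using last_path_le[OF ys(1)] Cons.prems by (intro b_antimono) auto
      moreover have "0 \<le> a y" using y by (simp add: a_eq P_nonneg)
      ultimately have "a y * b x \<le> a y * b (last (x # ys))" by (rule mult_left_mono)
      then show ?thesis
        by (intro exI[of _ ys]) (use ys P m in \<open>auto simp: algebra_simps\<close>)
    qed
  qed
qed

lemma seq_value_remaining:
  "s \<noteq> [] \<Longrightarrow> set s \<subseteq> {..<n} \<Longrightarrow> seq_value P t q s = remaining_value P t q 0 0 s"
  by (rule seq_value_eq_remaining_value) (auto simp: P_0 intro: q_nonneg)

lemma seq_value_path_ge:
  assumes "sorted_wrt (>) (n # ys)" "ys \<noteq> []"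
  shows "b (last ys) - path_cost a b (b (last ys)) n ys \<le> seq_value P t q (map ord ys)"
proof -
  have "set (map ord ys) \<subseteq> {..<n}" using assms by (auto intro: ord_less)
  then show ?thesis
    using remaining_value_path_ge[of n ys 0] assms by (simp add: seq_value_remaining P_0 b_n)
qed

lemma seq_value_nonneg:
  assumes "s \<noteq> []" "set s \<subseteq> {..<n}"
  shows "0 \<le> seq_value P t q s"
proof -
  have "0 \<le> c \<Longrightarrow> set s \<subseteq> {..<n} \<Longrightarrow> 0 \<le> remaining_value P t q \<tau> c s" for \<tau> c s
  proof (induction s arbitrary: \<tau> c)
    case (Cons r s)
    then show ?case using P_mono[of "real \<tau>" "real (\<tau> + t r)"] by simp
  qed (simp add: P_le_1)
  with assms show ?thesis by (simp add: seq_value_remaining)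
qed

text \<open>Every value is below some path bound, hence below \<open>v\<close>. The empty path has
  bound \<open>b n = 0\<close>, which is where \<open>0 \<le> v\<close> enters.\<close>

lemma optimal_sequenceI:
  assumes s: "s \<noteq> []" "set s \<subseteq> {..<n}" and v: "0 \<le> v" "v \<le> seq_value P t q s"
    and paths: "\<And>ys. sorted_wrt (>) (n # ys) \<Longrightarrow> ys \<noteq> [] \<Longrightarrow>
      b (last ys) - path_cost a b (b (last ys)) n ys \<le> v"
  shows "optimal_sequence P {..<n} t q s"
proof -
  have "seq_value P t q s' \<le> seq_value P t q s" if "s' \<in> sequences {..<n}" for s'
  proof -
    from that have s': "s' \<noteq> []" "set s' \<subseteq> {..<n}" by (auto simp: sequences_def)
    obtain ys where ys: "sorted_wrt (>) (n # ys)" "seq_value P t q s'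
        \<le> b (last (n # ys)) - path_cost a b (b (last (n # ys))) n ys"
      using remaining_value_le_path[of n s' 0] s' by (auto simp: seq_value_remaining P_0 b_n)
    then have "seq_value P t q s' \<le> v"
      using paths[of ys] v by (cases "ys = []") (auto simp: b_n)
    with v show ?thesis by simp
  qed
  with s show ?thesis
    by (auto simp: optimal_sequence_def is_arg_max_def sequences_def not_less)
qed

end

section \<open>Ranking the rules by quality\<close>

text \<open>Breaking ties by number gives a strict total order, so that ranks are distinct even for
  equal qualities.\<close>

definition precedes :: "(nat \<Rightarrow> real) \<Rightarrow> nat \<Rightarrow> nat \<Rightarrow> bool" where
  "precedes q j i \<longleftrightarrow> q i < q j \<or> q j = q i \<and> j < i"

definition quality_rank :: "nat \<Rightarrow> (nat \<Rightarrow> real) \<Rightarrow> nat \<Rightarrow> nat" where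
  "quality_rank n q i = card {j. j < n \<and> precedes q j i}"

text \<open>By transitivity the predecessors of \<open>j\<close> are predecessors of
  \<open>i\<close>, and \<open>j\<close> itself is one more.\<close>

lemma quality_rank_less_quality_rank:
  assumes "precedes q j i" "j < n"
  shows "quality_rank n q j < quality_rank n q i"
  unfolding quality_rank_def
proof (rule psubset_card_mono)
  have "j \<in> {k. k < n \<and> precedes q k i}" "j \<notin> {k. k < n \<and> precedes q k j}"
    using assms by (auto simp: precedes_def)
  moreover have "{k. k < n \<and> precedes q k j} \<subseteq> {k. k < n \<and> precedes q k i}"
    using assms by (auto simp: precedes_def)
  ultimately show "{k. k < n \<and> precedes q k j} \<subset> {k. k < n \<and> precedes q k i}" by blast
qed simp

lemma precedes_total: "i \<noteq> j \<Longrightarrow> precedes q i j \<or> precedes q j i"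
  by (auto simp: precedes_def)

lemma quality_rank_less:
  assumes "i < n"
  shows "quality_rank n q i < n"
proof -
  have "quality_rank n q i < card {..<n}"
    unfolding quality_rank_def by (rule psubset_card_mono) (use assms in \<open>auto simp: precedes_def\<close>)
  then show ?thesis by simp
qed

lemma inj_on_quality_rank: "inj_on (quality_rank n q) {..<n}"
  by (rule inj_onI) (metis lessThan_iff nat_neq_iff precedes_total quality_rank_less_quality_rank)

lemma bij_betw_quality_rank: "bij_betw (quality_rank n q) {..<n} {..<n}"
proof -
  have "quality_rank n q ` {..<n} \<subseteq> {..<n}" using quality_rank_less by auto
  then have "quality_rank n q ` {..<n} = {..<n}"
    using inj_on_quality_rank[of n q] by (intro endo_inj_surj) auto
  with inj_on_quality_rank show ?thesis by (auto simp: bij_betw_def)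
qed

text \<open>The array \<open>ord\<close> inverts the rank map and is therefore a bijection. A
  strictly larger quality forces a smaller rank, so \<open>b\<close> is antitone.\<close>

lemma sorted_data_quality_rank:
  assumes ranked: "\<And>i. i < n \<Longrightarrow>
      ord (quality_rank n q i) = i \<and> a (quality_rank n q i) = P (real (t i)) \<and> b (quality_rank n q i) = q i"
    and "b n = 0" and q: "\<And>i. i < n \<Longrightarrow> 0 \<le> q i"
  shows "sorted_data P n t q a b ord"
proof -
  have rankE: "\<exists>i<n. x = quality_rank n q i" if "x < n" for x
    using bij_betw_quality_rank[of n q] that unfolding bij_betw_def by (metis imageE lessThan_iff)
  have data: "\<forall>x<n. a x = P (real (t (ord x))) \<and> b x = q (ord x)"
    using rankE ranked by metis
  have "bij_betw ord {..<n} {..<n}"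
  proof (rule bij_betwI[where g = "quality_rank n q"])
    show "ord \<in> {..<n} \<rightarrow> {..<n}" using rankE ranked by fastforce
    show "quality_rank n q \<in> {..<n} \<rightarrow> {..<n}" using quality_rank_less by auto
    show "quality_rank n q (ord x) = x" if "x \<in> {..<n}" for x using rankE[of x] ranked that by force
    show "ord (quality_rank n q i) = i" if "i \<in> {..<n}" for i using ranked that by simp
  qed
  moreover have "b y \<le> b x" if xy: "x \<le> y" "y \<le> n" for x y
  proof (cases "y = n")
    case True
    show ?thesis
    proof (cases "x < n")
      case True
      then show ?thesis using rankE[of x] ranked q \<open>y = n\<close> \<open>b n = 0\<close> by force
    qed (use xy True in simp)
  next
    case False
    then obtain i j where ij: "i < n" "j < n" "x = quality_rank n q i" "y = quality_rank n q j"
      using xy rankE[of x] rankE[of y] by auto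
    have "q j \<le> q i"
    proof (rule ccontr)
      assume "\<not> q j \<le> q i"
      then have "precedes q j i" by (simp add: precedes_def)
      from quality_rank_less_quality_rank[OF this ij(2)] ij xy show False by simp
    qed
    then show ?thesis using ij ranked by simp
  qed
  ultimately show ?thesis using data \<open>b n = 0\<close> by (simp add: sorted_data_def)
qed

section \<open>Weakest preconditions with running time\<close>

notation Seq (infixr ";;" 60)

text \<open>Demanding a run expresses termination; the postcondition also sees the number of steps,
  so time and correctness are proved together.\<close>

definition wp ::
    "(real \<Rightarrow> real) \<Rightarrow> com \<Rightarrow> (nat \<Rightarrow> state \<Rightarrow> bool) \<Rightarrow> state \<Rightarrow> bool" where
  "wp P c Q \<sigma> \<longleftrightarrow> (\<exists>k \<sigma>'. run P c \<sigma> k \<sigma>' \<and> Q k \<sigma>')"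

lemma wp_Skip: "wp P Skip Q \<sigma> \<longleftrightarrow> Q 1 \<sigma>"
  unfolding wp_def by (metis run_Skip run_SkipE)

lemma wp_Instr: "wp P (Instr i) Q \<sigma> \<longleftrightarrow> Q 1 (exec P i \<sigma>)"
  unfolding wp_def by (metis run_Instr run_InstrE)

lemma wp_Seq: "wp P (c ;; d) Q \<sigma> \<longleftrightarrow> wp P c (\<lambda>k. wp P d (\<lambda>l. Q (k + l))) \<sigma>"
  unfolding wp_def by (blast intro: run_Seq elim: run_SeqE)

lemma run_Cond_iff:
  "run P (Cond b c d) \<sigma> k \<sigma>' \<longleftrightarrow>
    (\<exists>l. k = 1 + l \<and> run P (if test_holds b \<sigma> then c else d) \<sigma> l \<sigma>')"
proof
  assume "run P (Cond b c d) \<sigma> k \<sigma>'"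
  then show "\<exists>l. k = 1 + l \<and> run P (if test_holds b \<sigma> then c else d) \<sigma> l \<sigma>'"
    by (rule run_CondE) auto
next
  assume "\<exists>l. k = 1 + l \<and> run P (if test_holds b \<sigma> then c else d) \<sigma> l \<sigma>'"
  then show "run P (Cond b c d) \<sigma> k \<sigma>'"
    using run_CondT[of b \<sigma> P c] run_CondF[of b \<sigma> P d] by (auto split: if_splits)
qed

lemma wp_Cond: "wp P (Cond b c d) Q \<sigma> \<longleftrightarrow>
    wp P (if test_holds b \<sigma> then c else d) (\<lambda>k. Q (1 + k)) \<sigma>"
  unfolding wp_def by (auto simp: run_Cond_iff)

lemmas wp_simps = wp_Skip wp_Instr wp_Seq wp_Cond

lemma wp_mono:
  assumes "wp P c Q \<sigma>" "\<And>k \<sigma>'. Q k \<sigma>' \<Longrightarrow> Q' k \<sigma>'"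
  shows "wp P c Q' \<sigma>"
  using assms unfolding wp_def by blast

text \<open>Each iteration costs at most \<open>B\<close> plus one test and lowers
  \<open>\<mu>\<close> by at least 1; the failing test at the end accounts for the extra
  step.\<close>

lemma wp_Loop:
  fixes \<mu> :: "state \<Rightarrow> nat"
  assumes "I \<sigma>"
    and body: "\<And>\<sigma>. I \<sigma> \<Longrightarrow> test_holds b \<sigma> \<Longrightarrow> wp P c (\<lambda>k \<sigma>'. k \<le> B \<and> I \<sigma>' \<and> \<mu> \<sigma>' < \<mu> \<sigma>) \<sigma>"
  shows "wp P (Loop b c) (\<lambda>k \<sigma>'. k \<le> 1 + \<mu> \<sigma> * (B + 1) \<and> I \<sigma>' \<and> \<not> test_holds b \<sigma>') \<sigma>"
  using \<open>I \<sigma>\<close>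
proof (induction "\<mu> \<sigma>" arbitrary: \<sigma> rule: less_induct)
  case less
  show ?case
  proof (cases "test_holds b \<sigma>")
    case False
    with less.prems run_LoopF[OF False] show ?thesis unfolding wp_def by fastforce
  next
    case True
    with body[OF less.prems] obtain k \<sigma>1 where
      1: "run P c \<sigma> k \<sigma>1" "k \<le> B" "I \<sigma>1" "\<mu> \<sigma>1 < \<mu> \<sigma>" unfolding wp_def by blast
    from less.hyps[OF 1(4,3)] obtain l \<sigma>2 where
      2: "run P (Loop b c) \<sigma>1 l \<sigma>2" "l \<le> 1 + \<mu> \<sigma>1 * (B + 1)" "I \<sigma>2" "\<not> test_holds b \<sigma>2"
      unfolding wp_def by blast
    have "(\<mu> \<sigma>1 + 1) * (B + 1) \<le> \<mu> \<sigma> * (B + 1)" using 1(4) by (intro mult_right_mono) auto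
    then have "1 + k + l \<le> 1 + \<mu> \<sigma> * (B + 1)" using 1(2) 2(2) by (simp add: algebra_simps)
    with run_LoopT[OF True 1(1) 2(1)] 2(3,4) show ?thesis unfolding wp_def by blast
  qed
qed

section \<open>The program\<close>

text \<open>Counts in \<open>r\<close> the rules preceding rule \<open>i\<close>, whose quality is
  in \<open>x\<close>. Equality of reals is detected by two failing strict comparisons.\<close>

definition rank_loop :: com where
  "rank_loop =
    Loop (ILess ''j'' ''n'') (
      Instr (RLoad ''y'' ''q'' ''j'') ;;
      Cond (RLess ''x'' ''y'') (Instr (IAdd ''r'' ''r'' ''one''))
        (Cond (RLess ''y'' ''x'') Skip
          (Cond (ILess ''j'' ''i'') (Instr (IAdd ''r'' ''r'' ''one'')) Skip)) ;;
      Instr (IAdd ''j'' ''j'' ''one''))"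

text \<open>Each rule is written straight to the position given by its rank. The oracle is called
  here, once per rule.\<close>

definition sort_loop :: com where
  "sort_loop =
    Loop (ILess ''i'' ''n'') (
      Instr (RLoad ''x'' ''q'' ''i'') ;;
      Instr (INum ''r'' 0) ;;
      Instr (INum ''j'' 0) ;;
      rank_loop ;;
      Instr (RLoad ''y'' ''t'' ''i'') ;;
      Instr (Oracle ''y'' ''y'') ;;
      Instr (RStore ''a'' ''r'' ''y'') ;;
      Instr (RStore ''b'' ''r'' ''x'') ;;
      Instr (IStore ''ord'' ''r'' ''i'') ;;
      Instr (IAdd ''i'' ''i'' ''one''))"

text \<open>\<open>v\<close> is the least cost found so far from \<open>j\<close> to the target and
  \<open>p\<close> the first step attaining it; \<open>y\<close> holds the quality shortfall at
  \<open>j\<close>.\<close>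

definition relax_loop :: com where
  "relax_loop =
    Loop (ILess ''r'' ''j'') (
      Instr (RLoad ''w'' ''a'' ''r'') ;;
      Instr (RMul ''w'' ''w'' ''y'') ;;
      Instr (RLoad ''u'' ''g'' ''r'') ;;
      Instr (RAdd ''w'' ''w'' ''u'') ;;
      Cond (RLess ''w'' ''v'')
        (Instr (RCopy ''v'' ''w'') ;; Instr (ICopy ''p'' ''r'')) Skip ;;
      Instr (IAdd ''r'' ''r'' ''one''))"

text \<open>Dynamic programming from the target \<open>i\<close> upwards. The bound \<open>N\<close>
  is \<open>n + 1\<close>, so that the start vertex \<open>n\<close> gets an entry too.\<close>

definition table_loop :: com where
  "table_loop =
    Loop (ILess ''j'' ''N'') (
      Instr (RLoad ''y'' ''b'' ''j'') ;;
      Instr (RSub ''y'' ''x'' ''y'') ;;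
      Instr (RLoad ''v'' ''a'' ''i'') ;;
      Instr (RMul ''v'' ''v'' ''y'') ;;
      Instr (ICopy ''p'' ''i'') ;;
      Instr (ICopy ''r'' ''i'') ;;
      relax_loop ;;
      Instr (RStore ''g'' ''j'' ''v'') ;;
      Instr (IStore ''next'' ''j'' ''p'') ;;
      Instr (IAdd ''j'' ''j'' ''one''))"

text \<open>The hop is taken before the output, so the artificial start \<open>n\<close> is omitted
  and the target \<open>i\<close> is written last.\<close>

definition trace_loop :: com where
  "trace_loop =
    Loop (ILess ''i'' ''j'') (
      Instr (ILoad ''j'' ''next'' ''j'') ;;
      Instr (ILoad ''p'' ''ord'' ''j'') ;;
      Instr (IStore ''s'' ''m'' ''p'') ;;
      Instr (IAdd ''m'' ''m'' ''one''))"

definition target_loop :: com where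
  "target_loop =
    Loop (ILess ''i'' ''n'') (
      Instr (RLoad ''x'' ''b'' ''i'') ;;
      Instr (RNum ''y'' 0) ;;
      Instr (RStore ''g'' ''i'' ''y'') ;;
      Instr (IAdd ''j'' ''i'' ''one'') ;;
      table_loop ;;
      Instr (RLoad ''y'' ''g'' ''n'') ;;
      Instr (RSub ''y'' ''x'' ''y'') ;;
      Cond (RLess ''best'' ''y'')
        (Instr (RCopy ''best'' ''y'') ;;
         Instr (INum ''m'' 0) ;;
         Instr (ICopy ''j'' ''n'') ;;
         trace_loop) Skip ;;
      Instr (IAdd ''i'' ''i'' ''one''))"

text \<open>The default output is the single rule 0 with \<open>best\<close> 0. It survives only if
  no path bound is positive, and then all values are 0. The same 0 is stored as the quality of the
  start vertex.\<close>

definition deadline_program :: com where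
  "deadline_program =
    Instr (INum ''one'' 1) ;;
    Instr (IAdd ''N'' ''n'' ''one'') ;;
    Instr (INum ''i'' 0) ;;
    sort_loop ;;
    Instr (RNum ''best'' 0) ;;
    Instr (RStore ''b'' ''n'' ''best'') ;;
    Instr (INum ''i'' 0) ;;
    Instr (IStore ''s'' ''i'' ''i'') ;;
    Instr (INum ''m'' 1) ;;
    target_loop"

section \<open>Correctness of the program\<close>

lemma card_less_Suc_Collect:
  "card {j. j < Suc k \<and> p j} = card {j. j < k \<and> p j} + (if p k then 1 else 0)"
proof -
  have "{j. j < Suc k \<and> p j} = (if p k then insert k {j. j < k \<and> p j} else {j. j < k \<and> p j})"
    by (auto simp: less_Suc_eq)
  then show ?thesis by simp
qed

lemma rank_loop_correct:
  assumes "ireg \<sigma> ''n'' = n" "ireg \<sigma> ''one'' = 1" "ireg \<sigma> ''r'' = 0" "ireg \<sigma> ''j'' = 0"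
    and "rreg \<sigma> ''x'' = q (ireg \<sigma> ''i'')" "\<And>j. j < n \<Longrightarrow> rarr \<sigma> ''q'' j = q j"
  shows "wp P rank_loop (\<lambda>k \<sigma>'. k \<le> 1 + n * 7 \<and> ireg \<sigma>' ''r'' = quality_rank n q (ireg \<sigma> ''i'') \<and>
    ireg \<sigma>' ''n'' = n \<and> ireg \<sigma>' ''one'' = 1 \<and> ireg \<sigma>' ''N'' = ireg \<sigma> ''N'' \<and>
    ireg \<sigma>' ''i'' = ireg \<sigma> ''i'' \<and> rreg \<sigma>' ''x'' = rreg \<sigma> ''x'' \<and>
    iarr \<sigma>' = iarr \<sigma> \<and> rarr \<sigma>' = rarr \<sigma>) \<sigma>"
proof -
  define I where "I = (\<lambda>\<sigma>' :: state. ireg \<sigma>' ''j'' \<le> n \<and>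
    ireg \<sigma>' ''r'' = card {j. j < ireg \<sigma>' ''j'' \<and> precedes q j (ireg \<sigma> ''i'')} \<and>
    ireg \<sigma>' ''n'' = n \<and> ireg \<sigma>' ''one'' = 1 \<and> ireg \<sigma>' ''N'' = ireg \<sigma> ''N'' \<and>
    ireg \<sigma>' ''i'' = ireg \<sigma> ''i'' \<and> rreg \<sigma>' ''x'' = rreg \<sigma> ''x'' \<and>
    iarr \<sigma>' = iarr \<sigma> \<and> rarr \<sigma>' = rarr \<sigma>)"
  let ?\<mu> = "\<lambda>\<sigma> :: state. n - ireg \<sigma> ''j''"
  have "I \<sigma>" using assms by (simp add: I_def)
  \<comment> \<open>One load, at most three tests and one counted instruction, and the increment
    make 6 steps.\<close>
  from wp_Loop[where I = I and \<mu> = ?\<mu> and B = 6, OF this] show ?thesis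
    unfolding rank_loop_def
  proof (rule wp_mono, goal_cases)
    case (1 \<sigma>')
    then show ?case
      using assms(5,6)
      by (auto simp: wp_simps I_def card_less_Suc_Collect precedes_def)
  next
    case (2 k \<sigma>')
    then show ?case using assms(4) by (auto simp: I_def quality_rank_def)
  qed
qed

lemma sort_loop_correct:
  assumes "ireg \<sigma> ''n'' = n" "ireg \<sigma> ''one'' = 1" "ireg \<sigma> ''i'' = 0"
    and "\<And>i. i < n \<Longrightarrow> rarr \<sigma> ''t'' i = real (t i) \<and> rarr \<sigma> ''q'' i = q i"
  shows "wp P sort_loop (\<lambda>k \<sigma>'. k \<le> 1 + n * (7 * n + 11) \<and>
    ireg \<sigma>' ''n'' = n \<and> ireg \<sigma>' ''one'' = 1 \<and> ireg \<sigma>' ''N'' = ireg \<sigma> ''N'' \<and>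
    (\<forall>i<n. iarr \<sigma>' ''ord'' (quality_rank n q i) = i \<and>
       rarr \<sigma>' ''a'' (quality_rank n q i) = P (real (t i)) \<and> rarr \<sigma>' ''b'' (quality_rank n q i) = q i)) \<sigma>"
proof -
  define I where "I = (\<lambda>\<sigma>' :: state. ireg \<sigma>' ''i'' \<le> n \<and>
    ireg \<sigma>' ''n'' = n \<and> ireg \<sigma>' ''one'' = 1 \<and> ireg \<sigma>' ''N'' = ireg \<sigma> ''N'' \<and>
    rarr \<sigma>' ''t'' = rarr \<sigma> ''t'' \<and> rarr \<sigma>' ''q'' = rarr \<sigma> ''q'' \<and>
    (\<forall>i < ireg \<sigma>' ''i''. iarr \<sigma>' ''ord'' (quality_rank n q i) = i \<and>
       rarr \<sigma>' ''a'' (quality_rank n q i) = P (real (t i)) \<and> rarr \<sigma>' ''b'' (quality_rank n q i) = q i))"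
  let ?\<mu> = "\<lambda>\<sigma> :: state. n - ireg \<sigma> ''i''"
  have "I \<sigma>" using assms by (simp add: I_def)
  from wp_Loop[where I = I and \<mu> = ?\<mu> and B = "7 * n + 10", OF this] show ?thesis
    unfolding sort_loop_def
  proof (rule wp_mono, goal_cases)
    case (1 \<sigma>')
    \<comment> \<open>Distinct ranks ensure that the current writes leave the entries of earlier
      rules intact.\<close>
    have rank_neq: "quality_rank n q i \<noteq> quality_rank n q (ireg \<sigma>' ''i'')" if "i < ireg \<sigma>' ''i''" for i
      using inj_on_quality_rank[of n q] that 1 by (auto simp: I_def inj_on_def)
    show ?case
    proof (simp add: wp_simps, rule wp_mono[OF rank_loop_correct[where n = n and q = q]], goal_cases)
      case (7 k \<tau>)
      then show ?case
        using 1 assms(4) rank_neq by (simp add: wp_simps I_def less_Suc_eq diff_less_mono2)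
    qed (use 1 assms(4) in \<open>simp_all add: I_def\<close>)
  next
    case (2 k \<sigma>')
    then show ?case using assms(3) by (auto simp: I_def algebra_simps)
  qed
qed

text \<open>
  \<open>g j\<close> is the least cost of a path from \<open>j\<close> to the target \<open>m\<close>, and \<open>hop j\<close> is its first step.
\<close>

definition cost_table ::
    "(nat \<Rightarrow> real) \<Rightarrow> (nat \<Rightarrow> real) \<Rightarrow> nat \<Rightarrow> nat \<Rightarrow> (nat \<Rightarrow> real) \<Rightarrow> (nat \<Rightarrow> nat) \<Rightarrow> bool" where
  "cost_table a b m l g hop \<longleftrightarrow> g m = 0 \<and>
    (\<forall>j. m < j \<and> j < l \<longrightarrow>
      m \<le> hop j \<and> hop j < j \<and> g j = a (hop j) * (b m - b j) + g (hop j) \<and>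
      (\<forall>r. m \<le> r \<and> r < j \<longrightarrow> g j \<le> a r * (b m - b j) + g r))"

text \<open>Entries below \<open>l\<close> refer only to smaller indices, so updating at
  \<open>l\<close> preserves them; \<open>p\<close> is a best first step from
  \<open>l\<close>.\<close>

lemma cost_table_Suc:
  assumes "cost_table a b m l g hop" "m < l" "m \<le> p" "p < l"
    and "\<forall>r. m \<le> r \<and> r < l \<longrightarrow> a p * (b m - b l) + g p \<le> a r * (b m - b l) + g r"
  shows "cost_table a b m (Suc l) (g(l := a p * (b m - b l) + g p)) (hop(l := p))"
  using assms unfolding cost_table_def by (auto simp: less_Suc_eq)

text \<open>Along the path, the minimality clause of the table bounds \<open>g\<close> by the first
  edge plus \<open>g\<close> at its end.\<close>

lemma cost_table_le_path_cost:
  assumes "cost_table a b m l g hop" "sorted_wrt (>) (x # ys)" "last (x # ys) = m" "x < l"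
  shows "g x \<le> path_cost a b (b m) x ys"
  using assms(2-4)
proof (induction ys arbitrary: x)
  case Nil
  then show ?case using assms(1) by (simp add: cost_table_def)
next
  case (Cons y ys)
  have "m \<le> y" using last_path_le[of y ys] Cons.prems by simp
  moreover have "y < x" "x < l" using Cons.prems by auto
  ultimately have "g x \<le> a y * (b m - b x) + g y"
    using assms(1) unfolding cost_table_def by (meson le_less_trans)
  moreover have "g y \<le> path_cost a b (b m) y ys" using Cons.prems by (intro Cons.IH) auto
  ultimately show ?case by simp
qed

lemma relax_loop_correct:
  fixes \<sigma> :: state
  defines "f \<equiv> \<lambda>r. rarr \<sigma> ''a'' r * rreg \<sigma> ''y'' + rarr \<sigma> ''g'' r"
  assumes "ireg \<sigma> ''one'' = 1" "ireg \<sigma> ''r'' = i" "ireg \<sigma> ''p'' = i" "ireg \<sigma> ''j'' = j"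
    and "i < j" "j \<le> n" "rreg \<sigma> ''v'' = f i"
  shows "wp P relax_loop (\<lambda>k \<sigma>'. k \<le> 1 + n * 9 \<and>
    i \<le> ireg \<sigma>' ''p'' \<and> ireg \<sigma>' ''p'' < j \<and> rreg \<sigma>' ''v'' = f (ireg \<sigma>' ''p'') \<and>
    (\<forall>r. i \<le> r \<and> r < j \<longrightarrow> f (ireg \<sigma>' ''p'') \<le> f r) \<and>
    ireg \<sigma>' ''n'' = ireg \<sigma> ''n'' \<and> ireg \<sigma>' ''one'' = 1 \<and> ireg \<sigma>' ''N'' = ireg \<sigma> ''N'' \<and>
    ireg \<sigma>' ''i'' = ireg \<sigma> ''i'' \<and> ireg \<sigma>' ''j'' = j \<and> ireg \<sigma>' ''m'' = ireg \<sigma> ''m'' \<and>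
    rreg \<sigma>' ''x'' = rreg \<sigma> ''x'' \<and> rreg \<sigma>' ''best'' = rreg \<sigma> ''best'' \<and>
    iarr \<sigma>' = iarr \<sigma> \<and> rarr \<sigma>' = rarr \<sigma>) \<sigma>"
proof -
  define I where "I = (\<lambda>\<sigma>' :: state. i \<le> ireg \<sigma>' ''r'' \<and> ireg \<sigma>' ''r'' \<le> j \<and>
    i \<le> ireg \<sigma>' ''p'' \<and> ireg \<sigma>' ''p'' < j \<and> rreg \<sigma>' ''v'' = f (ireg \<sigma>' ''p'') \<and>
    (\<forall>r. i \<le> r \<and> r < ireg \<sigma>' ''r'' \<longrightarrow> f (ireg \<sigma>' ''p'') \<le> f r) \<and>
    ireg \<sigma>' ''n'' = ireg \<sigma> ''n'' \<and> ireg \<sigma>' ''one'' = 1 \<and> ireg \<sigma>' ''N'' = ireg \<sigma> ''N'' \<and>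
    ireg \<sigma>' ''i'' = ireg \<sigma> ''i'' \<and> ireg \<sigma>' ''j'' = j \<and> ireg \<sigma>' ''m'' = ireg \<sigma> ''m'' \<and>
    rreg \<sigma>' ''x'' = rreg \<sigma> ''x'' \<and> rreg \<sigma>' ''y'' = rreg \<sigma> ''y'' \<and>
    rreg \<sigma>' ''best'' = rreg \<sigma> ''best'' \<and>
    iarr \<sigma>' = iarr \<sigma> \<and> rarr \<sigma>' = rarr \<sigma>)"
  let ?\<mu> = "\<lambda>\<sigma> :: state. j - ireg \<sigma> ''r''"
  have "I \<sigma>" using assms(2-) by (simp add: I_def)
  from wp_Loop[where I = I and \<mu> = ?\<mu> and B = 8, OF this] show ?thesis
    unfolding relax_loop_def
  proof (rule wp_mono, goal_cases)
    case (1 \<sigma>')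
    then show ?case
      by (auto simp: wp_simps I_def less_Suc_eq f_def)
  next
    case (2 k \<sigma>')
    moreover have "(j - i) * 9 \<le> n * 9" using assms by simp
    ultimately show ?case using assms(3) by (auto simp: I_def)
  qed
qed

lemma table_loop_correct:
  assumes "ireg \<sigma> ''n'' = n" "ireg \<sigma> ''one'' = 1" "ireg \<sigma> ''N'' = Suc n"
    and "ireg \<sigma> ''i'' = i" "i < n" "ireg \<sigma> ''j'' = Suc i"
    and "rarr \<sigma> ''a'' = a" "rarr \<sigma> ''b'' = b" "rreg \<sigma> ''x'' = b i" "rarr \<sigma> ''g'' i = 0"
  shows "wp P table_loop (\<lambda>k \<sigma>'. k \<le> 1 + n * (9 * n + 11) \<and>
    cost_table a b i (Suc n) (rarr \<sigma>' ''g'') (iarr \<sigma>' ''next'') \<and>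
    ireg \<sigma>' ''n'' = n \<and> ireg \<sigma>' ''one'' = 1 \<and> ireg \<sigma>' ''N'' = Suc n \<and>
    ireg \<sigma>' ''i'' = i \<and> ireg \<sigma>' ''m'' = ireg \<sigma> ''m'' \<and>
    rreg \<sigma>' ''x'' = b i \<and> rreg \<sigma>' ''best'' = rreg \<sigma> ''best'' \<and>
    iarr \<sigma>' ''ord'' = iarr \<sigma> ''ord'' \<and> iarr \<sigma>' ''s'' = iarr \<sigma> ''s'' \<and>
    rarr \<sigma>' ''a'' = a \<and> rarr \<sigma>' ''b'' = b) \<sigma>"
proof -
  define I where "I = (\<lambda>\<sigma>' :: state. i < ireg \<sigma>' ''j'' \<and> ireg \<sigma>' ''j'' \<le> Suc n \<and>
    cost_table a b i (ireg \<sigma>' ''j'') (rarr \<sigma>' ''g'') (iarr \<sigma>' ''next'') \<and>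
    ireg \<sigma>' ''n'' = n \<and> ireg \<sigma>' ''one'' = 1 \<and> ireg \<sigma>' ''N'' = Suc n \<and>
    ireg \<sigma>' ''i'' = i \<and> ireg \<sigma>' ''m'' = ireg \<sigma> ''m'' \<and>
    rreg \<sigma>' ''x'' = b i \<and> rreg \<sigma>' ''best'' = rreg \<sigma> ''best'' \<and>
    iarr \<sigma>' ''ord'' = iarr \<sigma> ''ord'' \<and> iarr \<sigma>' ''s'' = iarr \<sigma> ''s'' \<and>
    rarr \<sigma>' ''a'' = a \<and> rarr \<sigma>' ''b'' = b)"
  let ?\<mu> = "\<lambda>\<sigma> :: state. Suc n - ireg \<sigma> ''j''"
  have "I \<sigma>" using assms by (simp add: I_def cost_table_def)
  from wp_Loop[where I = I and \<mu> = ?\<mu> and B = "9 * n + 10", OF this] show ?thesis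
    unfolding table_loop_def
  proof (rule wp_mono, goal_cases)
    case (1 \<sigma>')
    let ?j = "ireg \<sigma>' ''j''"
    have table: "cost_table a b i ?j (rarr \<sigma>' ''g'') (iarr \<sigma>' ''next'')" "i < ?j"
      using 1 by (simp_all add: I_def)
    \<comment> \<open>The program starts \<open>v\<close> with the direct step to \<open>i\<close>
      and adds no \<open>g i\<close>; this fact makes that value agree with the general
      formula.\<close>
    then have g: "rarr \<sigma>' ''g'' i = 0" by (simp add: cost_table_def)
    show ?case
    proof (simp add: wp_simps, rule wp_mono[OF relax_loop_correct[where n = n and i = i and j = ?j]], goal_cases)
      case (8 k \<tau>)
      let ?p = "ireg \<tau> ''p''"
      have "cost_table a b i (Suc ?j)
          ((rarr \<sigma>' ''g'')(?j := a ?p * (b i - b ?j) + rarr \<sigma>' ''g'' ?p))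
          ((iarr \<sigma>' ''next'')(?j := ?p))"
        by (intro cost_table_Suc[OF table]) (use 1 8 in \<open>simp_all add: I_def\<close>)
      then show ?case
        using 1 8 by (simp add: wp_simps I_def Suc_diff_le)
    qed (use 1 g in \<open>simp_all add: I_def\<close>)
  next
    case (2 k \<sigma>')
    moreover have "(n - i) * (9 * n + 11) \<le> n * (9 * n + 11)" by (intro mult_right_mono) auto
    moreover have "k \<le> 1 + (n - i) * (9 * n + 11)"
      using 2 assms(6) by (simp add: add.commute)
    ultimately have "k \<le> 1 + n * (9 * n + 11)" by linarith
    moreover have "ireg \<sigma>' ''j'' = Suc n" using 2 by (simp add: I_def)
    ultimately show ?case using 2 by (simp add: I_def)
  qed
qed

text \<open>Invariant: the path traced so far leads from \<open>n\<close> to \<open>j\<close>, and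
  its cost plus \<open>g j\<close> is \<open>g n\<close>. Hops go down, so \<open>j\<close> itself
  is the measure.\<close>

lemma trace_loop_correct:
  assumes "ireg \<sigma> ''n'' = n" "ireg \<sigma> ''one'' = 1" "ireg \<sigma> ''i'' = i" "i < n"
    and "ireg \<sigma> ''j'' = n" "ireg \<sigma> ''m'' = 0"
    and "iarr \<sigma> ''ord'' = ord" "iarr \<sigma> ''next'' = hop" "cost_table a b i (Suc n) g hop"
  shows "wp P trace_loop (\<lambda>k \<sigma>'. k \<le> 1 + n * 5 \<and>
    (\<exists>ys. sorted_wrt (>) (n # ys) \<and> ys \<noteq> [] \<and> last ys = i \<and>
       output_sequence \<sigma>' = map ord ys \<and> path_cost a b (b i) n ys = g n) \<and>
    ireg \<sigma>' ''n'' = n \<and> ireg \<sigma>' ''one'' = 1 \<and> ireg \<sigma>' ''N'' = ireg \<sigma> ''N'' \<and>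
    ireg \<sigma>' ''i'' = i \<and> rreg \<sigma>' ''best'' = rreg \<sigma> ''best'' \<and>
    iarr \<sigma>' ''ord'' = ord \<and> rarr \<sigma>' = rarr \<sigma>) \<sigma>"
proof -
  define I where "I = (\<lambda>\<sigma>' :: state. i \<le> ireg \<sigma>' ''j'' \<and> ireg \<sigma>' ''j'' \<le> n \<and>
    (\<exists>ys. sorted_wrt (>) (n # ys) \<and> last (n # ys) = ireg \<sigma>' ''j'' \<and>
       output_sequence \<sigma>' = map ord ys \<and>
       path_cost a b (b i) n ys + g (ireg \<sigma>' ''j'') = g n) \<and>
    ireg \<sigma>' ''n'' = n \<and> ireg \<sigma>' ''one'' = 1 \<and> ireg \<sigma>' ''N'' = ireg \<sigma> ''N'' \<and>
    ireg \<sigma>' ''i'' = i \<and> rreg \<sigma>' ''best'' = rreg \<sigma> ''best'' \<and>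
    iarr \<sigma>' ''ord'' = ord \<and> iarr \<sigma>' ''next'' = hop \<and> rarr \<sigma>' = rarr \<sigma>)"
  let ?\<mu> = "\<lambda>\<sigma> :: state. ireg \<sigma> ''j''"
  have "I \<sigma>" using assms by (auto simp: I_def output_sequence_def intro: exI[of _ "[]"])
  from wp_Loop[where I = I and \<mu> = ?\<mu> and B = 4, OF this] show ?thesis
    unfolding trace_loop_def
  proof (rule wp_mono, goal_cases)
    case (1 \<sigma>')
    then obtain ys where ys: "sorted_wrt (>) (n # ys)" "last (n # ys) = ireg \<sigma>' ''j''"
      "output_sequence \<sigma>' = map ord ys" "path_cost a b (b i) n ys + g (ireg \<sigma>' ''j'') = g n"
      by (auto simp: I_def)
    let ?x = "ireg \<sigma>' ''j''" let ?y = "hop ?x"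
    have x: "i < ?x" "?x \<le> n" using 1 by (auto simp: I_def)
    then have y: "i \<le> ?y" "?y < ?x" "g ?x = a ?y * (b i - b ?x) + g ?y"
      using assms(9) by (auto simp: cost_table_def)
    \<comment> \<open>The current vertex is the least one of the path, so a hop below it keeps the
      path decreasing.\<close>
    have "?x \<le> z" if "z \<in> set (n # ys)" for z
      using that ys(1,2) by (cases ys rule: rev_cases) (auto simp: sorted_wrt_append)
    then have "sorted_wrt (>) (n # ys @ [?y])"
      using ys(1) y(2) by (fastforce simp: sorted_wrt_append)
    moreover have "path_cost a b (b i) n (ys @ [?y]) + g ?y = g n"
      using ys y(3) by (simp add: path_cost_snoc)
    ultimately show ?case
      using 1 ys y x
      by (auto simp: wp_simps I_def output_sequence_def
          intro!: exI[of _ "ys @ [?y]"])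
  next
    case (2 k \<sigma>')
    then obtain ys where ys: "sorted_wrt (>) (n # ys)" "last (n # ys) = ireg \<sigma>' ''j''"
      "output_sequence \<sigma>' = map ord ys" "path_cost a b (b i) n ys + g (ireg \<sigma>' ''j'') = g n"
      by (auto simp: I_def)
    from 2 have "ireg \<sigma>' ''j'' = i" by (auto simp: I_def)
    moreover from this ys(2) \<open>i < n\<close> have "ys \<noteq> []" by auto
    moreover have "g i = 0" using assms(9) by (simp add: cost_table_def)
    ultimately show ?case using 2 ys assms(5) by (auto simp: I_def intro!: exI[of _ ys])
  qed
qed

section \<open>Optimizing over the last rule, and the total running time\<close>

context sorted_instance
begin

lemma target_loop_correct:
  assumes "ireg \<sigma> ''n'' = n" "ireg \<sigma> ''one'' = 1" "ireg \<sigma> ''N'' = Suc n" "ireg \<sigma> ''i'' = 0"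
    and "rarr \<sigma> ''a'' = a" "rarr \<sigma> ''b'' = b" "iarr \<sigma> ''ord'' = ord" "rreg \<sigma> ''best'' = 0"
    and "output_sequence \<sigma> \<noteq> []" "set (output_sequence \<sigma>) \<subseteq> {..<n}"
  shows "wp P target_loop (\<lambda>k \<sigma>'. k \<le> 1 + n * (9 * n * n + 16 * n + 14) \<and>
    optimal_sequence P {..<n} t q (output_sequence \<sigma>')) \<sigma>"
proof -
  define I where "I = (\<lambda>\<sigma>' :: state. ireg \<sigma>' ''i'' \<le> n \<and>
    ireg \<sigma>' ''n'' = n \<and> ireg \<sigma>' ''one'' = 1 \<and> ireg \<sigma>' ''N'' = Suc n \<and>
    rarr \<sigma>' ''a'' = a \<and> rarr \<sigma>' ''b'' = b \<and> iarr \<sigma>' ''ord'' = ord \<and>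
    output_sequence \<sigma>' \<noteq> [] \<and> set (output_sequence \<sigma>') \<subseteq> {..<n} \<and>
    0 \<le> rreg \<sigma>' ''best'' \<and> rreg \<sigma>' ''best'' \<le> seq_value P t q (output_sequence \<sigma>') \<and>
    (\<forall>ys. sorted_wrt (>) (n # ys) \<and> ys \<noteq> [] \<and> last ys < ireg \<sigma>' ''i'' \<longrightarrow>
      b (last ys) - path_cost a b (b (last ys)) n ys \<le> rreg \<sigma>' ''best''))"
  let ?\<mu> = "\<lambda>\<sigma> :: state. n - ireg \<sigma> ''i''"
  have "I \<sigma>" using assms seq_value_nonneg by (simp add: I_def)
  from wp_Loop[where I = I and \<mu> = ?\<mu> and B = "9 * n * n + 16 * n + 13", OF this] show ?thesis
    unfolding target_loop_def
  proof (rule wp_mono, goal_cases)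
    case (1 \<sigma>')
    let ?i = "ireg \<sigma>' ''i''"
    \<comment> \<open>An iteration adds the paths that end in \<open>?i\<close>, bounded by the
      table; all earlier ones are covered by the invariant.\<close>
    have paths: "b (last ys) - path_cost a b (b (last ys)) n ys \<le> v"
      if "cost_table a b ?i (Suc n) g hop" "rreg \<sigma>' ''best'' \<le> v" "b ?i - g n \<le> v"
        "sorted_wrt (>) (n # ys)" "ys \<noteq> []" "last ys < Suc ?i" for g hop v ys
    proof (cases "last ys = ?i")
      case True
      then show ?thesis using cost_table_le_path_cost[OF that(1,4)] that by auto
    next
      case False
      then show ?thesis using that 1 by (force simp: I_def)
    qed
    show ?case
    proof (simp add: wp_simps, rule wp_mono[OF table_loop_correct[where n = n and i = ?i and a = a and b = b]], goal_cases)
      case (11 k \<tau>)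
      let ?g = "rarr \<tau> ''g''"
      have table: "cost_table a b ?i (Suc n) ?g (iarr \<tau> ''next'')" using 11 by simp
      have k: "k \<le> 9 * n * n + 11 * n + 1" using 11 by (simp add: algebra_simps)
      show ?case
      proof (cases "rreg \<tau> ''best'' < rreg \<tau> ''x'' - ?g (ireg \<tau> ''n'')")
        case False
        then show ?thesis
          using 1 11 k paths[OF table]
          by (simp add: wp_simps I_def output_sequence_def)
      next
        case True
        then have better: "rreg \<sigma>' ''best'' < b ?i - ?g n" using 11 by simp
        show ?thesis
        proof (simp add: True wp_simps, rule wp_mono[OF trace_loop_correct[
              where n = n and i = ?i and ord = ord and hop = "iarr \<tau> ''next''" and g = ?g
                and a = a and b = b]], goal_cases)
          case (10 l \<tau>')
          then obtain ys where ys: "sorted_wrt (>) (n # ys)" "ys \<noteq> []" "last ys = ?i"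
            "output_sequence \<tau>' = map ord ys" "path_cost a b (b ?i) n ys = ?g n" by auto
          \<comment> \<open>\<open>best\<close> records the path bound and not the value of the
            output, which may be larger; the invariant asks for this inequality only.\<close>
          have "b ?i - ?g n \<le> seq_value P t q (output_sequence \<tau>')"
            using seq_value_path_ge[OF ys(1,2)] ys by simp
          moreover have "output_sequence \<tau>' \<noteq> []" "set (output_sequence \<tau>') \<subseteq> {..<n}"
            using ys by (auto intro: ord_less)
          ultimately show ?case
            using 1 10 11 k better paths[OF table, of "b ?i - ?g n"]
            by (simp add: wp_simps I_def output_sequence_def)
        qed (use 1 11 table in \<open>simp_all add: I_def\<close>)
      qed
    qed (use 1 in \<open>simp_all add: I_def\<close>)
  next
    case (2 k \<sigma>')
    then have "optimal_sequence P {..<n} t q (output_sequence \<sigma>')"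
      by (intro optimal_sequenceI[where v = "rreg \<sigma>' ''best''"]) (auto simp: I_def neq_Nil_conv)
    with 2 assms(4) show ?case by (simp add: add.commute)
  qed
qed

end

lemma deadline_program_correct:
  assumes "uniform_deadline P" "0 < n" and q: "\<And>i. i < n \<Longrightarrow> 0 \<le> q i" and "input_state n t q \<sigma>"
  shows "wp P deadline_program (\<lambda>k \<sigma>'. k \<le> 67 * n ^ 3 \<and>
    optimal_sequence P {..<n} t q (output_sequence \<sigma>')) \<sigma>"
  unfolding deadline_program_def wp_simps exec.simps
proof (rule wp_mono[OF sort_loop_correct[where n = n and q = q and t = t]], goal_cases)
  case (5 k \<tau>)
  let ?b = "(rarr \<tau> ''b'')(n := 0)"
  \<comment> \<open>The store at index \<open>n\<close> overwrites no rule.\<close>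
  have "quality_rank n q i \<noteq> n" if "i < n" for i using quality_rank_less[OF that, of q] by simp
  then have "sorted_data P n t q (rarr \<tau> ''a'') ?b (iarr \<tau> ''ord'')"
    using 5 q by (intro sorted_data_quality_rank) auto
  then interpret sorted_instance P n t q "rarr \<tau> ''a''" ?b "iarr \<tau> ''ord''"
    using assms(1) q by unfold_locales
  \<comment> \<open>Eight instructions stand outside the loops. Bounding every power of
    \<open>n\<close> by \<open>n ^ 3\<close> gives the constant 10 + 25 + 23 + 9 = 67.\<close>
  have bound: "k + l + 8 \<le> 67 * n ^ 3"
    if "l \<le> 1 + n * (9 * n * n + 16 * n + 14)" for l
  proof -
    have "1 \<le> n ^ 3" "n \<le> n ^ 3" "n ^ 2 \<le> n ^ 3"
      using \<open>0 < n\<close> by (auto intro: self_le_power power_increasing)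
    moreover have "k \<le> 1 + 7 * n ^ 2 + 11 * n" "l \<le> 1 + 9 * n ^ 3 + 16 * n ^ 2 + 14 * n"
      using 5 that by (auto simp: algebra_simps power2_eq_square power3_eq_cube)
    ultimately show ?thesis by linarith
  qed
  show ?case
  proof (rule wp_mono[OF target_loop_correct], goal_cases)
    case (11 l \<tau>')
    then show ?case using bound[of l] by simp
  qed (use 5 assms in \<open>simp_all add: output_sequence_def input_state_def\<close>)
qed (use assms in \<open>simp_all add: input_state_def\<close>)

theorem theorem5:
  "\<exists>(c :: com) (T :: nat \<Rightarrow> nat).
     (\<lambda>n. real (T n)) \<in> O(\<lambda>n. real n ^ 3) \<and>
     (\<forall>(n :: nat) (t :: nat \<Rightarrow> nat) (q :: nat \<Rightarrow> real) (P :: real \<Rightarrow> real) (\<sigma> :: state).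
        (\<forall>i<n. 0 \<le> q i) \<longrightarrow> short_uniform_deadline P {..<n} t \<longrightarrow> input_state n t q \<sigma> \<longrightarrow>
        (\<exists>k \<sigma>'. run P c \<sigma> k \<sigma>' \<and> k \<le> T n \<and>
           optimal_sequence P {..<n} t q (output_sequence \<sigma>')))"
proof (intro exI[of _ deadline_program] exI[of _ "\<lambda>n. 67 * n ^ 3"] conjI allI impI)
  show "(\<lambda>n. real (67 * n ^ 3)) \<in> O(\<lambda>n. real n ^ 3)" by simp
next
  fix n :: nat and t :: "nat \<Rightarrow> nat" and q :: "nat \<Rightarrow> real" and P :: "real \<Rightarrow> real" and \<sigma> :: state
  assume q: "\<forall>i<n. 0 \<le> q i" and P: "short_uniform_deadline P {..<n} t" and "input_state n t q \<sigma>"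
  \<comment> \<open>For \<open>n = 0\<close> the sum of probabilities is empty and cannot exceed
    1.\<close>
  have "0 < n" using P by (cases n) (auto simp: short_uniform_deadline_def)
  with q P \<open>input_state n t q \<sigma>\<close> show "\<exists>k \<sigma>'. run P deadline_program \<sigma> k \<sigma>' \<and> k \<le> 67 * n ^ 3 \<and>
      optimal_sequence P {..<n} t q (output_sequence \<sigma>')"
    using deadline_program_correct[of P n q t \<sigma>]
    by (auto simp: short_uniform_deadline_def wp_def)
qed

end
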